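(* Let $\mathcal{G}=\langle a,b,c\rangle\le \mathrm{Aut}(\{0,1\}^* )$ be the group of automorphisms of the binary rooted tree generated by $a=(1,1)\sigma$, $b=(a,c)$, $c=(b,1)$ (this is the iterated monodromy group $\mathrm{IMG}(z^2+\mathrm{i})$). Then $\mathcal{G}$ has the following presentation on the generators $a,b,c$: $$\mathcal{G}\cong\bigl\langle a,b,c\bigm| \phi^n(a^2),\ \phi^n\bigl((ac)^4\bigr),\ \phi^n([c,ab]^2),\ \phi^n([c,bab]^2),\ \phi^n([c,ababa]^2),\ \phi^n([c,ababab]^2),\ \phi^n([c,bababab]^2),\ n\geq 0\bigr\rangle,$$ where $\phi$ is the substitution defined by $a\mapsto b$, $b\mapsto c$, $c\mapsto aba$.
   Context: Let $X=\{0,1\}$; the set $X^*$ of finite words over $X$ is the binary rooted tree ($v$ is adjacent to $vx$ for $x\in X$). Every tree automorphism $g$ is written uniquely as $g=(g|_0,g|_1)\sigma_g$, where $\sigma_g\in\mathrm{Sym}(2)$ is the permutation of $X$ induced by $g$ and $g|_x\in\mathrm{Aut}(X^* )$ is determined by $g(xw)=\sigma_g(x)\,g|_x(w)$ for all $w\in X^*$. Products are defined by $gh(w)=h(g(w))$, so $gh=(g|_0h|_{\sigma_g(0)},\,g|_1h|_{\sigma_g(1)})\sigma_g\sigma_h$. The nontrivial element of $\mathrm{Sym}(2)$ is denoted $\sigma$; the recursions $a=(1,1)\sigma$, $b=(a,c)$, $c=(b,1)$ define $a,b,c$ uniquely. Commutators are $[g,h]=g^{-1}h^{-1}gh$. The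 isomorphism sends the abstract generators $a,b,c$ to the automorphisms $a,b,c$. The substitution $\phi$ is extended to an endomorphism of the free group on $\{a,b,c\}$. *)

theory Defs
  imports "HOL-Algebra.Elementary_Groups"
begin

section \<open>Free groups and presentations\<close>

text \<open>A letter \<open>(x, True)\<close> stands for the generator \<open>x\<close>, and \<open>(x, False)\<close> for its inverse.
  The free group on the type \<open>'x\<close> consists of the reduced words.\<close>

type_synonym 'x letter = "'x \<times> bool"

definition inv_letter :: "'x letter \<Rightarrow> 'x letter"
  where "inv_letter l = (fst l, \<not> snd l)"

definition reduced :: "'x letter list \<Rightarrow> bool"
  where "reduced = successively (\<lambda>l m. m \<noteq> inv_letter l)"

fun cons_red :: "'x letter \<Rightarrow> 'x letter list \<Rightarrow> 'x letter list" where
  "cons_red l [] = [l]"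
| "cons_red l (m # w) = (if m = inv_letter l then w else l # m # w)"

definition reduce :: "'x letter list \<Rightarrow> 'x letter list"
  where "reduce w = foldr cons_red w []"

definition free_group :: "'x letter list monoid"
  where "free_group =
    \<lparr>carrier = {w. reduced w}, mult = (\<lambda>u v. reduce (u @ v)), one = []\<rparr>"

definition free_gen :: "'x \<Rightarrow> 'x letter list"
  where "free_gen x = [(x, True)]"

text \<open>The homomorphism from the free group to \<open>H\<close> that extends \<open>f\<close>.\<close>

definition free_lift :: "('h, 'm) monoid_scheme \<Rightarrow> ('x \<Rightarrow> 'h) \<Rightarrow> 'x letter list \<Rightarrow> 'h"
  where "free_lift H f w =
    foldr (\<lambda>(x, s) h. (if s then f x else inv\<^bsub>H\<^esub> f x) \<otimes>\<^bsub>H\<^esub> h) w \<one>\<^bsub>H\<^esub>"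

definition normal_closure :: "('g, 'm) monoid_scheme \<Rightarrow> 'g set \<Rightarrow> 'g set"
  where "normal_closure G R = \<Inter>{N. N \<lhd> G \<and> R \<subseteq> N}"

definition presented_group :: "'x letter list set \<Rightarrow> 'x letter list set monoid"
  where "presented_group R = free_group Mod normal_closure free_group R"

definition presented_gen :: "'x letter list set \<Rightarrow> 'x \<Rightarrow> 'x letter list set"
  where "presented_gen R x = normal_closure free_group R #>\<^bsub>free_group\<^esub> free_gen x"

lemma inv_letter_inv_letter [simp]: "inv_letter (inv_letter l) = l"
  by (simp add: inv_letter_def)

lemma reduced_Nil [simp]: "reduced []"
  by (simp add: reduced_def)

lemma reduced_Cons: "reduced (l # w) \<longleftrightarrow> reduced w \<and> (w = [] \<or> hd w \<noteq> inv_letter l)"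
  by (cases w) (auto simp: reduced_def)

lemma reduced_cons_red: "reduced w \<Longrightarrow> reduced (cons_red l w)"
  by (cases w) (auto simp: reduced_Cons)

lemma cons_red_inv: "reduced w \<Longrightarrow> cons_red l (cons_red (inv_letter l) w) = w"
  by (cases w rule: remdups_adj.cases) (auto simp: reduced_Cons)

lemma reduced_foldr: "reduced v \<Longrightarrow> reduced (foldr cons_red u v)"
  by (induction u) (auto intro: reduced_cons_red)

lemma reduced_reduce [simp]: "reduced (reduce w)"
  by (simp add: reduce_def reduced_foldr)

lemma foldr_cons_red_cons_red:
  assumes "reduced v"
  shows "foldr cons_red (cons_red l u) v = cons_red l (foldr cons_red u v)"
  using assms cons_red_inv[OF reduced_foldr[OF assms]] by (cases u) auto

lemma foldr_reduce: "reduced v \<Longrightarrow> foldr cons_red (reduce u) v = foldr cons_red u v"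
  by (induction u) (auto simp: reduce_def foldr_cons_red_cons_red)

lemma reduce_append: "reduce (u @ v) = foldr cons_red u (reduce v)"
  by (simp add: reduce_def)

lemma reduce_reduced: "reduced w \<Longrightarrow> reduce w = w"
proof (induction w)
  case (Cons l w)
  then have "reduce w = w" by (simp add: reduced_Cons)
  with Cons.prems show ?case by (cases w) (auto simp: reduce_def reduced_Cons)
qed (simp add: reduce_def)

lemma inverse_word: "reduce (map inv_letter (rev w) @ w) = []"
proof -
  have "foldr cons_red (map inv_letter (rev w)) (foldr cons_red w v) = v" if "reduced v" for v
    using that
  proof (induction w arbitrary: v)
    case (Cons l w)
    then show ?case
      using cons_red_inv[of "foldr cons_red w v" "inv_letter l"] by (simp add: reduced_foldr)
  qed simp
  then show ?thesis by (simp add: reduce_def)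
qed

lemma group_free_group: "group (free_group :: 'x letter list monoid)"
proof (rule groupI)
  fix u v w :: "'x letter list"
  assume "u \<in> carrier free_group" "v \<in> carrier free_group" "w \<in> carrier free_group"
  then show "u \<otimes>\<^bsub>free_group\<^esub> v \<otimes>\<^bsub>free_group\<^esub> w = u \<otimes>\<^bsub>free_group\<^esub> (v \<otimes>\<^bsub>free_group\<^esub> w)"
    by (simp add: free_group_def reduce_append foldr_reduce reduce_reduced reduced_foldr)
       (metis foldr_append foldr_reduce reduce_append reduce_reduced)
next
  fix u :: "'x letter list"
  assume "u \<in> carrier free_group"
  have "reduce (map inv_letter (rev u)) \<otimes>\<^bsub>free_group\<^esub> u = \<one>\<^bsub>free_group\<^esub>"
    by (simp add: free_group_def reduce_append foldr_reduce inverse_word flip: reduce_append)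
       (metis foldr_reduce inverse_word reduce_append reduced_reduce)
  then show "\<exists>v\<in>carrier free_group. v \<otimes>\<^bsub>free_group\<^esub> u = \<one>\<^bsub>free_group\<^esub>"
    by (rule bexI) (simp add: free_group_def)
qed (auto simp: free_group_def reduce_reduced)

lemma free_gen_closed [simp]: "free_gen x \<in> carrier free_group"
  by (simp add: free_gen_def free_group_def reduced_Cons)

lemma free_lift_closed:
  assumes "group H" "\<And>x. f x \<in> carrier H"
  shows "free_lift H f w \<in> carrier H"
proof -
  interpret group H by fact
  show ?thesis by (induction w) (auto simp: free_lift_def assms(2))
qed

lemma free_lift_gen:
  assumes "group H" "\<And>x. f x \<in> carrier H"
  shows "free_lift H f (free_gen x) = f x"
proof -
  interpret group H by fact
  show ?thesis by (simp add: free_lift_def free_gen_def assms(2))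
qed

lemma free_lift_hom:
  assumes "group H" and f: "\<And>x. f x \<in> carrier H"
  shows "free_lift H f \<in> hom free_group H"
proof -
  interpret group H by fact
  let ?L = "free_lift H f"
  note closed = free_lift_closed[of H f, OF assms]
  have hCons: "?L (l # w) = ?L [l] \<otimes>\<^bsub>H\<^esub> ?L w" for l w
    using closed[of w] f by (cases l) (simp add: free_lift_def)
  have cancel: "?L [l] \<otimes>\<^bsub>H\<^esub> ?L [inv_letter l] = \<one>\<^bsub>H\<^esub>" for l
    using f by (cases l) (simp add: free_lift_def inv_letter_def)
  have cons: "?L (cons_red l w) = ?L [l] \<otimes>\<^bsub>H\<^esub> ?L w" for l w
  proof (cases w)
    case Nil
    then show ?thesis using closed[of "[l]"] by (simp add: free_lift_def[of H f "[]"])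
  next
    case (Cons m v)
    then show ?thesis
      using cancel[of l] closed hCons[of m v] hCons[of l "m # v"]
      by (auto simp flip: m_assoc)
  qed
  have "?L (foldr cons_red u v) = ?L u \<otimes>\<^bsub>H\<^esub> ?L v" for u v
  proof (induction u)
    case Nil
    then show ?case using closed by (simp add: free_lift_def[of H f "[]"])
  next
    case (Cons l u)
    then show ?case using closed cons hCons[of l u] by (simp add: m_assoc)
  qed
  then show ?thesis
    by (auto intro!: homI simp: closed free_group_def reduce_append reduce_reduced)
qed

lemma normal_closure_normal:
  assumes "group G" "R \<subseteq> carrier G"
  shows "normal_closure G R \<lhd> G"
proof -
  interpret group G by fact
  have top: "carrier G \<lhd> G"
    by (rule normal_invI) (auto intro: subgroup_self)
  then have "subgroup (normal_closure G R) G"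
    unfolding normal_closure_def using assms(2)
    by (intro subgroups_Inter) (auto dest: normal_imp_subgroup)
  then show ?thesis
    by (rule normal_invI) (auto simp: normal_closure_def intro: normal.inv_op_closed2)
qed


section \<open>Automorphisms of the binary rooted tree\<close>

text \<open>The vertices are the words over \<open>{0, 1}\<close>, where \<open>False\<close> is 0 and \<open>True\<close> is 1.\<close>

definition adjacent :: "bool list \<Rightarrow> bool list \<Rightarrow> bool"
  where "adjacent u v \<longleftrightarrow> (\<exists>x. v = u @ [x] \<or> u = v @ [x])"

definition tree_auts :: "(bool list \<Rightarrow> bool list) set"
  where "tree_auts =
    {g. bij g \<and> g [] = [] \<and> (\<forall>u v. adjacent (g u) (g v) \<longleftrightarrow> adjacent u v)}"

text \<open>Automorphisms act from the right: the product \<open>g h\<close> applies \<open>g\<close> first.\<close>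

definition tree_group :: "(bool list \<Rightarrow> bool list) monoid"
  where "tree_group = \<lparr>carrier = tree_auts, mult = (\<lambda>g h. h \<circ> g), one = id\<rparr>"

text \<open>\<open>wreath g\<^sub>0 g\<^sub>1 s\<close> is the automorphism written \<open>(g\<^sub>0, g\<^sub>1) s\<close>.\<close>

fun wreath :: "(bool list \<Rightarrow> bool list) \<Rightarrow> (bool list \<Rightarrow> bool list) \<Rightarrow> (bool \<Rightarrow> bool)
    \<Rightarrow> bool list \<Rightarrow> bool list" where
  "wreath g0 g1 s [] = []"
| "wreath g0 g1 s (x # w) = s x # (if x then g1 else g0) w"

fun aut_a :: "bool list \<Rightarrow> bool list"
  and aut_b :: "bool list \<Rightarrow> bool list"
  and aut_c :: "bool list \<Rightarrow> bool list" where
  "aut_a [] = []"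
| "aut_a (x # w) = (\<not> x) # w"
| "aut_b [] = []"
| "aut_b (x # w) = x # (if x then aut_c w else aut_a w)"
| "aut_c [] = []"
| "aut_c (x # w) = x # (if x then w else aut_b w)"

lemma wreath_recursions:
  "aut_a = wreath id id Not" "aut_b = wreath aut_a aut_c id" "aut_c = wreath aut_b id id"
proof -
  show "aut_a = wreath id id Not"
  proof
    show "aut_a w = wreath id id Not w" for w by (cases w) auto
  qed
  show "aut_b = wreath aut_a aut_c id"
  proof
    show "aut_b w = wreath aut_a aut_c id w" for w by (cases w) auto
  qed
  show "aut_c = wreath aut_b id id"
  proof
    show "aut_c w = wreath aut_b id id w" for w by (cases w) auto
  qed
qed

lemma wreath_recursions_unique:
  assumes a: "a = wreath id id Not" and b: "b = wreath a c id" and c: "c = wreath b id id"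
  shows "a = aut_a" "b = aut_b" "c = aut_c"
proof -
  have b': "b [] = []" "b (x # w) = x # (if x then c else a) w" for x w
    using fun_cong[OF b] by auto
  have c': "c [] = []" "c (x # w) = x # (if x then id else b) w" for x w
    using fun_cong[OF c] by auto
  show a': "a = aut_a" using a wreath_recursions(1) by simp
  have "b w = aut_b w \<and> c w = aut_c w" for w
    by (induction w) (auto simp: b' c' a')
  then show "b = aut_b" "c = aut_c" by auto
qed

lemma group_tree_group: "group tree_group"
proof (rule groupI)
  fix g assume "g \<in> carrier tree_group"
  then have g: "bij g" "g [] = []" "\<And>u v. adjacent (g u) (g v) \<longleftrightarrow> adjacent u v"
    by (auto simp: tree_group_def tree_auts_def)
  from g(1) have eq: "g (inv_into UNIV g w) = w" for w
    by (simp add: bij_is_surj surj_f_inv_f)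
  have "inv_into UNIV g \<in> tree_auts"
    using g eq by (auto simp: tree_auts_def bij_imp_bij_inv bij_is_inj inv_f_eq)
       (metis eq g(3))+
  moreover have "inv_into UNIV g \<otimes>\<^bsub>tree_group\<^esub> g = \<one>\<^bsub>tree_group\<^esub>"
    using eq by (auto simp: tree_group_def)
  ultimately show "\<exists>h\<in>carrier tree_group. h \<otimes>\<^bsub>tree_group\<^esub> g = \<one>\<^bsub>tree_group\<^esub>"
    by (intro bexI[of _ "inv_into UNIV g"]) (auto simp: tree_group_def)
qed (auto simp: tree_group_def tree_auts_def bij_comp comp_assoc)

lemma auts_closed: "aut_a \<in> tree_auts" "aut_b \<in> tree_auts" "aut_c \<in> tree_auts"
proof -
  have *: "g \<in> tree_auts"
    if inv: "\<And>w. g (g w) = w" and Nil: "g [] = []"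
      and snoc: "\<And>w x. \<exists>y. g (w @ [x]) = g w @ [y]" for g
  proof -
    have "bij g" using inv by (rule involuntory_imp_bij)
    moreover have "adjacent (g u) (g v)" if "adjacent u v" for u v
      using that snoc by (fastforce simp: adjacent_def)
    ultimately show ?thesis
      using inv Nil by (auto simp: tree_auts_def) (metis inv)
  qed
  have a: "aut_a (aut_a w) = w" for w by (cases w) auto
  have bc: "aut_b (aut_b w) = w \<and> aut_c (aut_c w) = w" for w
    by (induction w) (auto simp: a)
  have sa: "\<exists>y. aut_a (w @ [x]) = aut_a w @ [y]" for w x by (cases w) auto
  have sbc: "(\<exists>y. aut_b (w @ [x]) = aut_b w @ [y]) \<and> (\<exists>y. aut_c (w @ [x]) = aut_c w @ [y])" for w x
    using sa by (induction w) auto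
  show "aut_a \<in> tree_auts" "aut_b \<in> tree_auts" "aut_c \<in> tree_auts"
    using a bc sa sbc by (auto intro!: *)
qed

definition img_group :: "(bool list \<Rightarrow> bool list) monoid"
  where "img_group = subgroup_generated tree_group {aut_a, aut_b, aut_c}"


section \<open>The relators\<close>

datatype gen = GenA | GenB | GenC

abbreviation free_mult :: "gen letter list \<Rightarrow> gen letter list \<Rightarrow> gen letter list"
    (infixl \<open>\<cdot>\<close> 70)
  where "u \<cdot> v \<equiv> u \<otimes>\<^bsub>free_group\<^esub> v"

abbreviation free_pow :: "gen letter list \<Rightarrow> nat \<Rightarrow> gen letter list"
    (infixr \<open>\<up>\<close> 75)
  where "u \<up> n \<equiv> u [^]\<^bsub>free_group\<^esub> n"

definition free_comm :: "gen letter list \<Rightarrow> gen letter list \<Rightarrow> gen letter list"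
  where "free_comm g h = inv\<^bsub>free_group\<^esub> g \<cdot> inv\<^bsub>free_group\<^esub> h \<cdot> g \<cdot> h"

definition phi :: "gen letter list \<Rightarrow> gen letter list"
  where "phi = free_lift free_group
    (\<lambda>x. case x of
        GenA \<Rightarrow> free_gen GenB
      | GenB \<Rightarrow> free_gen GenC
      | GenC \<Rightarrow> free_gen GenA \<cdot> free_gen GenB \<cdot> free_gen GenA)"

definition base_relators :: "gen letter list set"
  where "base_relators =
    (let a = free_gen GenA; b = free_gen GenB; c = free_gen GenC
     in {a \<up> 2,
         (a \<cdot> c) \<up> 4,
         free_comm c (a \<cdot> b) \<up> 2,
         free_comm c (b \<cdot> a \<cdot> b) \<up> 2,
         free_comm c (a \<cdot> b \<cdot> a \<cdot> b \<cdot> a) \<up> 2,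
         free_comm c (a \<cdot> b \<cdot> a \<cdot> b \<cdot> a \<cdot> b) \<up> 2,
         free_comm c (b \<cdot> a \<cdot> b \<cdot> a \<cdot> b \<cdot> a \<cdot> b) \<up> 2})"

definition img_relators :: "gen letter list set"
  where "img_relators = {(phi ^^ n) r | n r. r \<in> base_relators}"

lemma phi_hom: "phi \<in> hom free_group free_group"
proof -
  interpret F: group free_group by (rule group_free_group)
  show ?thesis
    unfolding phi_def
    by (rule free_lift_hom[OF group_free_group]) (auto split: gen.split)
qed

lemma img_relators_closed: "img_relators \<subseteq> carrier free_group"
proof -
  interpret F: group free_group by (rule group_free_group)
  have "base_relators \<subseteq> carrier free_group"
    by (simp add: base_relators_def Let_def free_comm_def)
  moreover have "(phi ^^ n) r \<in> carrier free_group" if "r \<in> carrier free_group" for n r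
    using that phi_hom by (induction n) (auto simp: hom_def)
  ultimately show ?thesis by (auto simp: img_relators_def)
qed

end

theory Submission
  imports Defs
begin

text \<open>The substitution satisfies \<open>\<phi>(g) = (g, \<delta>(g))\<close>, where the endomorphism \<open>\<delta>\<close> with
  \<open>a \<mapsto> c\<close>, \<open>b \<mapsto> 1\<close>, \<open>c \<mapsto> a\<close> takes values in the dihedral group \<open>D = \<langle>a, c\<rangle>\<close> of order 8;
  hence the relators hold in the tree group.

  Conversely let \<open>\<Gamma>\<close> be the presented group and \<open>B\<close> the normal closure of \<open>b\<close>, which is
  generated by the conjugates of \<open>b\<close> under \<open>D\<close>. Every element of the index 2 subgroup
  \<open>\<langle>b, c, aba, aca\<rangle>\<close> of \<open>\<Gamma>\<close> has the form \<open>\<phi>(d) \<phi>(k) a \<phi>(l) a\<close> with \<open>d \<in> D\<close> and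
  \<open>k, l \<in> B\<close>. The only relations needed for this are that \<open>\<phi>(B)\<close> commutes with
  \<open>a \<phi>(B) a\<close>, which means that \<open>c\<close> commutes with \<open>y\<^sup>-\<^sup>1 c y\<close> for
  \<open>y = a \<phi>(z)\<close>, \<open>z \<in> D\<close>; up to inversion of \<open>y\<close> these are the given relators. Such an
  element has the sections \<open>d k\<close> and \<open>\<delta>(d) l\<close>, so it is trivial in \<open>\<Gamma>\<close> as soon as its
  sections are. Since sections of words get shorter, induction on the length shows that a word
  acting trivially on the tree is trivial in \<open>\<Gamma>\<close>.\<close>

section \<open>Products along words in involutions\<close>

text \<open>In the groups to which this is applied the generators are involutions, so exponents are
  dropped and words are plain lists of generators.\<close>

definition word_prod :: "('h, 'm) monoid_scheme \<Rightarrow> ('x \<Rightarrow> 'h) \<Rightarrow> 'x list \<Rightarrow> 'h"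
  where "word_prod H f w = foldr (\<lambda>x h. f x \<otimes>\<^bsub>H\<^esub> h) w \<one>\<^bsub>H\<^esub>"

lemma word_prod_simps [simp]:
  "word_prod H f [] = \<one>\<^bsub>H\<^esub>"
  "word_prod H f (x # w) = f x \<otimes>\<^bsub>H\<^esub> word_prod H f w"
  by (simp_all add: word_prod_def)

locale involutions = group H for H (structure) +
  fixes f :: "'x \<Rightarrow> 'a"
  assumes gen_closed [simp]: "f x \<in> carrier H"
    and gen_sq [simp]: "f x \<otimes> f x = \<one>"
begin

lemma word_prod_closed [simp]: "word_prod H f w \<in> carrier H"
  by (induction w) auto

lemma word_prod_append: "word_prod H f (u @ v) = word_prod H f u \<otimes> word_prod H f v"
  by (induction u) (auto simp: m_assoc)

lemma gen_cancel [simp]: "y \<in> carrier H \<Longrightarrow> f x \<otimes> (f x \<otimes> y) = y"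
  by (simp flip: m_assoc)

lemma inv_gen [simp]: "inv f x = f x"
  by (simp add: inv_equality)

lemma inv_word_prod: "inv word_prod H f w = word_prod H f (rev w)"
  by (induction w) (auto simp: word_prod_append inv_mult_group)

lemma free_lift_eq_word_prod: "free_lift H f u = word_prod H f (map fst u)"
  by (induction u) (auto simp: free_lift_def)

lemma word_prod_concat:
  "word_prod H f (concat (map s w)) = word_prod H (\<lambda>x. word_prod H f (s x)) w"
  by (induction w) (auto simp: word_prod_append)

end

lemma hom_word_prod:
  assumes "group G" "group H" "h \<in> hom G H" "\<And>x. f x \<in> carrier G"
  shows "h (word_prod G f w) = word_prod H (\<lambda>x. h (f x)) w"
proof -
  interpret group_hom G H h
    using assms by (simp add: group_hom_def group_hom_axioms_def)
  have "word_prod G f w \<in> carrier G" for w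
    using assms(4) by (induction w) auto
  then show ?thesis
    using assms(4) by (induction w) auto
qed


section \<open>Presented groups\<close>

lemma free_group_simps [simp]:
  "w \<in> carrier free_group \<longleftrightarrow> reduced w"
  "u \<otimes>\<^bsub>free_group\<^esub> v = reduce (u @ v)"
  "\<one>\<^bsub>free_group\<^esub> = []"
  by (simp_all add: free_group_def)

lemma inv_free_group:
  assumes "reduced w"
  shows "inv\<^bsub>free_group\<^esub> w = reduce (map inv_letter (rev w))"
proof -
  interpret group free_group by (rule group_free_group)
  have "reduce (reduce (map inv_letter (rev w)) @ w) = reduce (map inv_letter (rev w) @ w)"
    by (metis assms foldr_reduce reduce_append reduce_reduced)
  then show ?thesis
    using assms by (intro inv_equality) (auto simp: inverse_word)
qed

text \<open>A reduced word \<open>l # w\<close> is the product of \<open>[l]\<close> and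
  \<open>w\<close> without cancellation, so the values on generators determine a homomorphism letter
  by letter.\<close>

lemma free_lift_unique:
  assumes "group H" "h \<in> hom free_group H" "reduced w"
  shows "h w = free_lift H (\<lambda>x. h (free_gen x)) w"
proof -
  interpret group_hom free_group H h
    using assms group_free_group by (simp add: group_hom_def group_hom_axioms_def)
  show ?thesis
    using \<open>reduced w\<close>
  proof (induction w)
    case Nil
    then show ?case using hom_one by (simp add: free_lift_def)
  next
    case (Cons l w)
    obtain x s where l: "l = (x, s)" by (cases l)
    have "reduced [l]" "reduced w" "reduce ([l] @ w) = l # w"
      using Cons.prems by (auto simp: reduced_Cons reduce_reduced simp del: reduced_reduce)
    then have "h (l # w) = h [l] \<otimes>\<^bsub>H\<^esub> h w"
      using hom_mult[of "[l]" w] by simp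
    moreover have "h [l] = (if s then h (free_gen x) else inv\<^bsub>H\<^esub> h (free_gen x))"
    proof (cases s)
      case False
      have "[l] = inv\<^bsub>free_group\<^esub> (free_gen x)"
        using free_gen_closed[of x] False l
        by (subst inv_free_group) (auto simp: free_gen_def inv_letter_def reduce_def)
      then show ?thesis
        using False hom_inv[OF free_gen_closed] by simp
    qed (simp add: l free_gen_def)
    ultimately show ?case
      using Cons \<open>reduced w\<close> l by (simp add: free_lift_def)
  qed
qed

context
  fixes R :: "'x letter list set"
  assumes R: "R \<subseteq> carrier free_group"
begin

lemma normal_relators: "normal_closure free_group R \<lhd> free_group"
  using R by (rule normal_closure_normal[OF group_free_group])

lemma group_presented_group: "group (presented_group R)"
  unfolding presented_group_def by (rule normal.factorgroup_is_group[OF normal_relators])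

lemma quotient_hom:
  "(\<lambda>w. normal_closure free_group R #>\<^bsub>free_group\<^esub> w) \<in> hom free_group (presented_group R)"
  unfolding presented_group_def by (rule normal.r_coset_hom_Mod[OF normal_relators])

lemma presented_gen_closed: "presented_gen R x \<in> carrier (presented_group R)"
  unfolding presented_gen_def using quotient_hom free_gen_closed by (rule hom_in_carrier)

lemma coset_eq_free_lift:
  assumes "reduced w"
  shows "normal_closure free_group R #>\<^bsub>free_group\<^esub> w
    = free_lift (presented_group R) (presented_gen R) w"
  using free_lift_unique[OF group_presented_group quotient_hom assms]
  by (simp add: presented_gen_def[abs_def])

lemma presented_group_relator:
  assumes "r \<in> R"
  shows "free_lift (presented_group R) (presented_gen R) r = \<one>\<^bsub>presented_group R\<^esub>"
proof -
  interpret F: group free_group by (rule group_free_group)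
  have "r \<in> normal_closure free_group R"
    using assms by (auto simp: normal_closure_def)
  moreover have "reduced r" using assms R by auto
  ultimately show ?thesis
    using F.coset_join2 normal_imp_subgroup[OF normal_relators] coset_eq_free_lift
    by (metis free_group_simps(1) one_FactGroup presented_group_def)
qed

text \<open>Von Dyck's theorem: the kernel of \<open>free_lift H f\<close> is normal and contains
  \<open>R\<close>, hence contains the normal closure of \<open>R\<close>.\<close>

lemma presented_group_universal:
  assumes "group H" "\<And>x. f x \<in> carrier H"
    and "\<And>r. r \<in> R \<Longrightarrow> free_lift H f r = \<one>\<^bsub>H\<^esub>"
  obtains h where "h \<in> hom (presented_group R) H" "\<And>x. h (presented_gen R x) = f x"
proof -
  interpret group_hom free_group H "free_lift H f"
    using assms(1,2) group_free_group free_lift_hom[of H f]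
    by (simp add: group_hom_def group_hom_axioms_def)
  have "R \<subseteq> kernel free_group H (free_lift H f)"
    using R assms(3) by (auto simp: kernel_def)
  then have "normal_closure free_group R \<subseteq> kernel free_group H (free_lift H f)"
    using normal_kernel by (auto simp: normal_closure_def)
  then obtain g where "g \<in> hom (free_group Mod normal_closure free_group R) H"
    and g: "\<And>w. w \<in> carrier free_group \<Longrightarrow>
      g (normal_closure free_group R #>\<^bsub>free_group\<^esub> w) = free_lift H f w"
    using FactGroup_universal_kernel[OF normal_relators] by blast
  moreover have "g (presented_gen R x) = f x" for x
    using g[OF free_gen_closed] free_lift_gen[of H f, OF assms(1,2)]
    by (simp add: presented_gen_def)
  ultimately show ?thesis
    using that[of g] by (simp add: presented_group_def)
qed

lemma presented_group_cases:
  assumes "X \<in> carrier (presented_group R)"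
  obtains w where "X = free_lift (presented_group R) (presented_gen R) w"
  using assms coset_eq_free_lift by (auto simp: presented_group_def carrier_FactGroup)

end


section \<open>The relators as positive words\<close>

fun phi_letter :: "gen \<Rightarrow> gen list" where
  "phi_letter GenA = [GenB]"
| "phi_letter GenB = [GenC]"
| "phi_letter GenC = [GenA, GenB, GenA]"

text \<open>The second sections of the substituted letters: \<open>b = (a, c)\<close>,
  \<open>c = (b, 1)\<close> and \<open>aba = (c, a)\<close>.\<close>

fun delta_letter :: "gen \<Rightarrow> gen list" where
  "delta_letter GenA = [GenC]"
| "delta_letter GenB = []"
| "delta_letter GenC = [GenA]"

definition phi_word :: "gen list \<Rightarrow> gen list"
  where "phi_word w = concat (map phi_letter w)"

definition delta_word :: "gen list \<Rightarrow> gen list"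
  where "delta_word w = concat (map delta_letter w)"

definition comm_words :: "gen list set"
  where "comm_words =
    {[GenA, GenB],
     [GenB, GenA, GenB],
     [GenA, GenB, GenA, GenB, GenA],
     [GenA, GenB, GenA, GenB, GenA, GenB],
     [GenB, GenA, GenB, GenA, GenB, GenA, GenB]}"

text \<open>The commutator \<open>[c, y]\<close>, with \<open>rev y\<close> as the inverse of a
  product of involutions.\<close>

definition comm_word :: "gen list \<Rightarrow> gen list"
  where "comm_word y = GenC # rev y @ GenC # y"

definition base_words :: "gen list set"
  where "base_words =
    {[GenA, GenA], [GenA, GenC, GenA, GenC, GenA, GenC, GenA, GenC]}
    \<union> (\<lambda>y. comm_word y @ comm_word y) ` comm_words"

lemma base_relators_words: "map fst ` base_relators = base_words"
  by (auto simp: base_relators_def Let_def free_comm_def numeral_eq_Suc inv_free_group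
      free_gen_def reduced_Cons reduce_def inv_letter_def base_words_def comm_words_def
      comm_word_def)

text \<open>The words \<open>b\<close>, \<open>c\<close>, \<open>aba\<close> are palindromes of odd
  length, so their values are again involutions, and \<open>f\<close> may be replaced by its
  composite with the substitution.\<close>

lemma involutions_phi:
  assumes "involutions H f"
  shows "involutions H (\<lambda>x. word_prod H f (phi_letter x))"
proof -
  interpret involutions H f by fact
  show ?thesis
  proof
    show "word_prod H f (phi_letter x) \<otimes>\<^bsub>H\<^esub> word_prod H f (phi_letter x) = \<one>\<^bsub>H\<^esub>" for x
      by (cases x) (auto simp: m_assoc)
  qed simp
qed

lemma involutions_delta:
  assumes "involutions H f"
  shows "involutions H (\<lambda>x. word_prod H f (delta_letter x))"
proof -
  interpret involutions H f by fact
  show ?thesis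
  proof
    show "word_prod H f (delta_letter x) \<otimes>\<^bsub>H\<^esub> word_prod H f (delta_letter x) = \<one>\<^bsub>H\<^esub>" for x
      by (cases x) (auto simp: m_assoc)
  qed simp
qed

lemma free_lift_phi:
  assumes "involutions H f" "reduced u"
  shows "free_lift H f (phi u) = free_lift H (\<lambda>x. word_prod H f (phi_letter x)) u"
proof -
  interpret involutions H f by fact
  have h: "free_lift H f \<circ> phi \<in> hom free_group H"
    using phi_hom free_lift_hom[of H f, OF is_group gen_closed] by (rule Group.hom_compose)
  have "free_lift H f (phi (free_gen x)) = word_prod H f (phi_letter x)" for x
  proof -
    have "phi (free_gen x) = map (\<lambda>y. (y, True)) (phi_letter x)"
      unfolding phi_def
      by (subst free_lift_gen[OF group_free_group])
         (auto split: gen.split simp: free_gen_def reduced_Cons reduce_def inv_letter_def;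
          cases x; simp add: reduce_def inv_letter_def)+
    then show ?thesis by (simp add: free_lift_eq_word_prod comp_def)
  qed
  then show ?thesis
    using free_lift_unique[OF is_group h assms(2)] by simp
qed

lemma reduced_phi_pow:
  assumes "reduced r"
  shows "reduced ((phi ^^ n) r)"
  using assms hom_in_carrier[OF phi_hom] by (induction n) auto

text \<open>The outermost \<open>phi\<close> is absorbed into \<open>f\<close>, hence the induction
  over arbitrary \<open>f\<close>.\<close>

lemma free_lift_phi_pow:
  assumes "involutions H f" "reduced r"
  shows "free_lift H f ((phi ^^ n) r) = word_prod H f ((phi_word ^^ n) (map fst r))"
  using assms(1)
proof (induction n arbitrary: f)
  case 0
  then show ?case by (simp add: involutions.free_lift_eq_word_prod)
next
  case (Suc n)
  show ?case
    using Suc.IH[OF involutions_phi[OF Suc.prems]] free_lift_phi[OF Suc.prems]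
      reduced_phi_pow[OF assms(2)] involutions.word_prod_concat[OF Suc.prems, of phi_letter]
    by (simp add: phi_word_def[symmetric])
qed

text \<open>The substitution acts linearly on the three letter counts, so evenness is inherited from
  the base words.\<close>

lemma even_count_phi_pow:
  assumes "w \<in> base_words"
  shows "even (count_list ((phi_word ^^ n) w) x)"
proof (induction n arbitrary: x)
  case 0
  show ?case
    using assms by (cases x) (auto simp: base_words_def comm_words_def comm_word_def)
next
  case (Suc n)
  have "count_list (phi_word v) GenA = 2 * count_list v GenC"
    "count_list (phi_word v) GenB = count_list v GenA + count_list v GenC"
    "count_list (phi_word v) GenC = count_list v GenB" for v
    by (induction v; simp add: phi_word_def; case_tac a; simp)+
  then show ?case using Suc by (cases x) auto
qed

text \<open>Each \<open>y\<close> in \<open>comm_words\<close> has an odd number of letters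
  \<open>a\<close>, so \<delta> turns \<open>y\<close> into \<open>c\<close> and
  \<open>[c, y]^2\<close> into \<open>(ac)^4\<close>. For \<open>n > 0\<close>, \<delta> after
  \<phi> sends \<open>b\<close> to \<open>a\<close> and kills \<open>a\<close> and \<open>c\<close>,
  which leaves an even power of \<open>a\<close>.\<close>

lemma delta_relators:
  assumes "involutions H f"
    and ac: "word_prod H f [GenA, GenC, GenA, GenC, GenA, GenC, GenA, GenC] = \<one>\<^bsub>H\<^esub>"
    and w: "w \<in> base_words"
  shows "word_prod H f (delta_word ((phi_word ^^ n) w)) = \<one>\<^bsub>H\<^esub>"
proof -
  interpret involutions H f by fact
  have ca: "word_prod H f [GenC, GenA, GenC, GenA, GenC, GenA, GenC, GenA] = \<one>\<^bsub>H\<^esub>"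
    using arg_cong[OF ac, of "m_inv H"] by (simp add: inv_word_prod del: word_prod_simps)
  show ?thesis
  proof (cases n)
    case 0
    show ?thesis
      using w ac ca unfolding base_words_def comm_words_def
      by (auto simp: 0 comm_word_def delta_word_def)
  next
    case (Suc m)
    have "word_prod H f (delta_word (phi_word v))
        = (if even (count_list v GenB) then \<one>\<^bsub>H\<^esub> else f GenA)" for v
    proof (induction v)
      case (Cons x v)
      then show ?case by (cases x) (auto simp: delta_word_def phi_word_def)
    qed (simp add: delta_word_def phi_word_def)
    then show ?thesis
      using even_count_phi_pow[OF w] by (simp add: Suc)
  qed
qed


section \<open>Sections of words acting on the tree\<close>

fun gen_aut :: "gen \<Rightarrow> bool list \<Rightarrow> bool list" where
  "gen_aut GenA = aut_a"
| "gen_aut GenB = aut_b"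
| "gen_aut GenC = aut_c"

abbreviation act :: "gen list \<Rightarrow> bool list \<Rightarrow> bool list"
  where "act \<equiv> word_prod tree_group gen_aut"

text \<open>Letters act from left to right; an \<open>a\<close> contributes nothing but moves the
  rest of the word to the other subtree.\<close>

fun sec :: "bool \<Rightarrow> gen list \<Rightarrow> gen list" where
  "sec x [] = []"
| "sec x (GenA # w) = sec (\<not> x) w"
| "sec x (GenB # w) = (if x then GenC else GenA) # sec x w"
| "sec x (GenC # w) = (if x then sec x w else GenB # sec x w)"

interpretation tree: involutions tree_group gen_aut
proof -
  have a: "aut_a (aut_a w) = w" for w by (cases w) auto
  have "aut_b (aut_b w) = w \<and> aut_c (aut_c w) = w" for w
    by (induction w) (auto simp: a)
  then have "gen_aut x \<circ> gen_aut x = id" for x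
    using a by (cases x) auto
  moreover have "gen_aut x \<in> tree_auts" for x
    using auts_closed by (cases x) auto
  ultimately show "involutions tree_group gen_aut"
    by (simp add: involutions_def group_tree_group involutions_axioms_def)
       (simp add: tree_group_def)
qed

lemma one_tree_group: "\<one>\<^bsub>tree_group\<^esub> = id"
  by (simp add: tree_group_def)

lemma act_Nil_Cons: "act [] v = v" "act (x # w) v = act w (gen_aut x v)"
  by (simp_all add: tree_group_def)

lemma act_Cons: "act w (x # v) = (x \<noteq> odd (count_list w GenA)) # act (sec x w) v"
proof (induction w arbitrary: x v)
  case (Cons y w)
  then show ?case
    by (cases y; cases x) (simp_all add: act_Nil_Cons del: word_prod_simps)
qed (simp add: act_Nil_Cons del: word_prod_simps)

lemma act_eq_id_iff:
  "act w = id \<longleftrightarrow>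
    even (count_list w GenA) \<and> act (sec False w) = id \<and> act (sec True w) = id"
proof
  assume w: "act w = id"
  have "act w (x # v) = x # v" for x v
    using w by simp
  then show "even (count_list w GenA) \<and> act (sec False w) = id \<and> act (sec True w) = id"
    unfolding act_Cons by (auto simp: fun_eq_iff)
next
  assume "even (count_list w GenA) \<and> act (sec False w) = id \<and> act (sec True w) = id"
  moreover have "act w [] = []"
    by (induction w; simp add: act_Nil_Cons del: word_prod_simps; case_tac a; simp)
  ultimately have "act w v = v" for v
  proof (cases v)
    case (Cons x v')
    with \<open>even _ \<and> _\<close> show ?thesis by (cases x) (simp_all add: act_Cons)
  qed simp
  then show "act w = id" by auto
qed

lemma act_eq_idD:
  assumes "act w = id"
  shows "even (count_list w GenA)" "act (sec x w) = id"
proof -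
  have "even (count_list w GenA) \<and> act (sec False w) = id \<and> act (sec True w) = id"
    using assms act_eq_id_iff by blast
  then show "even (count_list w GenA)" "act (sec x w) = id" by (simp, cases x, simp_all)
qed

text \<open>Since \<open>y\<close> has an odd number of letters \<open>a\<close>, the elements
  \<open>c = (b, 1)\<close> and \<open>y^-1 c y\<close> act on different subtrees. The sections of
  \<open>[c, y]\<close> are thus conjugates of \<open>b\<close>, and those of its square are
  trivial.\<close>

lemma act_base_words:
  assumes "w \<in> base_words"
  shows "act w = id"
proof -
  have "even (count_list w GenA) \<and> act (sec False w) = \<one>\<^bsub>tree_group\<^esub>
    \<and> act (sec True w) = \<one>\<^bsub>tree_group\<^esub>"
    using assms unfolding base_words_def comm_words_def
    by (auto simp: comm_word_def simp del: gen_aut.simps)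
  then show ?thesis
    using act_eq_id_iff[of w] by (simp add: one_tree_group)
qed

lemma sec_phi_word: "sec False (phi_word w) = w" "sec True (phi_word w) = delta_word w"
proof -
  have "sec False (phi_word w) = w \<and> sec True (phi_word w) = delta_word w"
  proof (induction w)
    case (Cons x w)
    then show ?case by (cases x) (auto simp: phi_word_def delta_word_def)
  qed (simp add: phi_word_def delta_word_def)
  then show "sec False (phi_word w) = w" "sec True (phi_word w) = delta_word w" by auto
qed

lemma act_phi_pow:
  assumes "w \<in> base_words"
  shows "act ((phi_word ^^ n) w) = id"
proof (induction n)
  case 0
  show ?case using act_base_words[OF assms] by simp
next
  case (Suc n)
  have "[GenA, GenC, GenA, GenC, GenA, GenC, GenA, GenC] \<in> base_words"
    by (simp add: base_words_def)
  then have "act (delta_word ((phi_word ^^ n) w)) = id"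
    using delta_relators[OF tree.involutions_axioms _ assms] act_base_words
    by (simp add: one_tree_group del: word_prod_simps)
  moreover have "even (count_list ((phi_word ^^ Suc n) w) GenA)"
    using even_count_phi_pow[OF assms] .
  ultimately show ?case
    using Suc by (subst act_eq_id_iff) (simp add: sec_phi_word id_def)
qed

lemma length_sec: "length (sec x w) + count_list w GenA \<le> length w"
  by (induction x w rule: sec.induct) auto

text \<open>This serves the case where the first section may be as long as the word: each
  \<open>b\<close> puts an \<open>a\<close> into the first section and a \<open>c\<close> into the
  second.\<close>

lemma sec_without_a:
  assumes "GenA \<notin> set w"
  shows "set (sec True w) \<subseteq> {GenC}" "GenB \<in> set w \<Longrightarrow> GenA \<in> set (sec False w)"
proof -
  have "set (sec True w) \<subseteq> {GenC} \<and> (GenB \<in> set w \<longrightarrow> GenA \<in> set (sec False w))"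
    using assms
  proof (induction w)
    case (Cons x w)
    then show ?case by (cases x) auto
  qed simp
  then show "set (sec True w) \<subseteq> {GenC}" "GenB \<in> set w \<Longrightarrow> GenA \<in> set (sec False w)"
    by auto
qed

lemma even_length_of_act_c:
  assumes "set w \<subseteq> {GenC}" "act w = id"
  shows "even (length w)"
proof -
  \<comment> \<open>By \<open>c = (b, 1)\<close> and \<open>b = (a, c)\<close>, each
    \<open>c\<close> flips the letter following the vertex 00.\<close>
  have "act w [False, False, s] = [False, False, s \<noteq> odd (length w)]" for s
    using assms(1)
    by (induction w arbitrary: s) (auto simp: act_Nil_Cons simp del: word_prod_simps)
  from this[of False] show ?thesis using assms(2) by simp
qed


section \<open>The kernel of the action\<close>

text \<open>An abstraction of the presented group: the endomorphism \<phi> carries the base relators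
  to all the others.\<close>

locale img_presentation = involutions G f
  for G :: "('a, 'm) monoid_scheme" (structure) and f :: "gen \<Rightarrow> 'a" +
  fixes \<phi> \<delta> :: "'a \<Rightarrow> 'a"
  assumes phi_endo: "\<phi> \<in> hom G G" and delta_endo: "\<delta> \<in> hom G G"
    and phi_gen: "\<phi> (f x) = word_prod G f (phi_letter x)"
    and delta_gen: "\<delta> (f x) = word_prod G f (delta_letter x)"
    and base_rel: "w \<in> base_words \<Longrightarrow> word_prod G f w = \<one>"
begin

abbreviation a where "a \<equiv> f GenA"
abbreviation b where "b \<equiv> f GenB"
abbreviation c where "c \<equiv> f GenC"

sublocale phi: group_hom G G \<phi>
  using phi_endo by unfold_locales

sublocale delta: group_hom G G \<delta>
  using delta_endo by unfold_locales

lemma phi_gens [simp]: "\<phi> a = b" "\<phi> b = c" "\<phi> c = a \<otimes> (b \<otimes> a)"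
  by (simp_all add: phi_gen)

lemma delta_gens [simp]: "\<delta> a = c" "\<delta> b = \<one>" "\<delta> c = a"
  by (simp_all add: delta_gen)

lemma inv_cancel [simp]:
  assumes "x \<in> carrier G" "y \<in> carrier G"
  shows "inv x \<otimes> (x \<otimes> y) = y" "x \<otimes> (inv x \<otimes> y) = y"
  using assms by (simp_all flip: m_assoc)

section \<open>The dihedral group \<open>D\<close> and the conjugates of \<open>b\<close> under
  it\<close>

inductive_set D :: "'a set" where
  D_one: "\<one> \<in> D"
| D_a: "d \<in> D \<Longrightarrow> a \<otimes> d \<in> D"
| D_c: "d \<in> D \<Longrightarrow> c \<otimes> d \<in> D"

inductive_set B :: "'a set" where
  B_one: "\<one> \<in> B"
| B_conj: "d \<in> D \<Longrightarrow> k \<in> B \<Longrightarrow> inv d \<otimes> (b \<otimes> (d \<otimes> k)) \<in> B"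

lemma D_closed [simp]: "d \<in> D \<Longrightarrow> d \<in> carrier G"
  by (induction rule: D.induct) auto

lemma B_closed [simp]: "k \<in> B \<Longrightarrow> k \<in> carrier G"
  by (induction rule: B.induct) auto

lemma D_mult: "d \<in> D \<Longrightarrow> e \<in> D \<Longrightarrow> d \<otimes> e \<in> D"
  by (induction rule: D.induct) (auto simp: m_assoc intro: D.intros)

lemma D_inv: "d \<in> D \<Longrightarrow> inv d \<in> D"
proof (induction rule: D.induct)
  case D_one
  then show ?case by (simp add: D.D_one)
next
  case (D_a d)
  then show ?case using D_mult[of "inv d" a] D.D_a[OF D.D_one] by (simp add: inv_mult_group)
next
  case (D_c d)
  then show ?case using D_mult[of "inv d" c] D.D_c[OF D.D_one] by (simp add: inv_mult_group)
qed

lemma delta_D: "d \<in> D \<Longrightarrow> \<delta> d \<in> D \<and> \<delta> (\<delta> d) = d"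
  by (induction rule: D.induct) (auto intro: D.intros)

lemma delta_B: "k \<in> B \<Longrightarrow> \<delta> k = \<one>"
  by (induction rule: B.induct) auto

lemma ac_rel: "a \<otimes> (c \<otimes> (a \<otimes> (c \<otimes> a))) = c \<otimes> (a \<otimes> c)"
proof -
  have "word_prod G f [GenA, GenC, GenA, GenC, GenA, GenC, GenA, GenC] = \<one>"
    by (rule base_rel) (simp add: base_words_def)
  then have "a \<otimes> (c \<otimes> (a \<otimes> (c \<otimes> a))) \<otimes> (c \<otimes> (a \<otimes> c)) = \<one>"
    by (simp add: m_assoc)
  then have "a \<otimes> (c \<otimes> (a \<otimes> (c \<otimes> a))) = inv (c \<otimes> (a \<otimes> c))"
    by (intro inv_equality[symmetric]) auto
  then show ?thesis by (simp add: inv_mult_group m_assoc)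
qed

lemma D_cases:
  assumes "d \<in> D"
  shows "d \<in> {\<one>, a, c, a \<otimes> c, c \<otimes> a, a \<otimes> (c \<otimes> a), c \<otimes> (a \<otimes> c),
    c \<otimes> (a \<otimes> (c \<otimes> a))}"
proof -
  \<comment> \<open>Only \<open>a\<close> times \<open>cac\<close> and \<open>a\<close> times
    \<open>caca\<close> leave the list; this identity and \<open>ac_rel\<close> bring them
    back.\<close>
  have "a \<otimes> (c \<otimes> (a \<otimes> c)) = c \<otimes> (a \<otimes> (c \<otimes> a))"
    using arg_cong[OF ac_rel, of "\<lambda>x. a \<otimes> x"]
      arg_cong[OF ac_rel, of "\<lambda>x. a \<otimes> (c \<otimes> x)"]
      arg_cong[OF ac_rel, of "\<lambda>x. c \<otimes> x"]
    by simp
  with assms ac_rel show ?thesis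
    by (induction rule: D.induct) auto
qed

section \<open>Commutation of \<open>\<phi>(B)\<close> with \<open>a \<phi>(B) a\<close>\<close>

definition commutes_conj :: "'a \<Rightarrow> bool"
  where "commutes_conj y \<longleftrightarrow> c \<otimes> (inv y \<otimes> (c \<otimes> y)) = inv y \<otimes> (c \<otimes> (y \<otimes> c))"

text \<open>Conjugation by \<open>y\<close> exchanges the roles of the two elements. This supplies
  the reversals of the words in \<open>comm_words\<close>.\<close>

lemma commutes_conj_inv:
  assumes "y \<in> carrier G" "commutes_conj y"
  shows "commutes_conj (inv y)"
proof -
  have "y \<otimes> (c \<otimes> (inv y \<otimes> (c \<otimes> y))) \<otimes> inv y = y \<otimes> (inv y \<otimes> (c \<otimes> (y \<otimes> c))) \<otimes> inv y"
    using assms by (simp add: commutes_conj_def)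
  then show ?thesis
    using assms by (simp add: commutes_conj_def m_assoc)
qed

lemma square_one_commute:
  assumes "x \<in> carrier G" "y \<in> carrier G" "x \<otimes> x = \<one>" "y \<otimes> y = \<one>"
    and "x \<otimes> y \<otimes> (x \<otimes> y) = \<one>"
  shows "x \<otimes> y = y \<otimes> x"
proof -
  have "inv x = x" "inv y = y" "inv (x \<otimes> y) = x \<otimes> y"
    using assms by (simp_all only: inv_equality m_closed)
  then show ?thesis
    using inv_mult_group[of x y] assms(1,2) by metis
qed

text \<open>\<open>[c, y]\<close> is the product of the involutions \<open>c\<close> and
  \<open>y^-1 c y\<close>, so they commute once its square is trivial.\<close>

lemma commutes_conj_word:
  assumes "word_prod G f (comm_word y @ comm_word y) = \<one>"
  shows "commutes_conj (word_prod G f y)"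
proof -
  let ?y = "word_prod G f y"
  have "c \<otimes> (inv ?y \<otimes> (c \<otimes> ?y)) = inv ?y \<otimes> (c \<otimes> ?y) \<otimes> c"
    using assms
    by (intro square_one_commute)
       (simp_all add: comm_word_def word_prod_append m_assoc flip: inv_word_prod)
  then show ?thesis by (simp add: commutes_conj_def m_assoc)
qed

text \<open>For \<open>z\<close> equal to \<open>1, a, c, ac, ca, aca, cac, caca\<close> the element
  is \<open>a, ab, ba, ababa, bab, ababab, bababa, bababab\<close>. Up to reversal these are
  \<open>a\<close> and the words in \<open>comm_words\<close>.\<close>

lemma commutes_conj_D:
  assumes "z \<in> D"
  shows "commutes_conj (a \<otimes> \<phi> z)"
proof -
  have "commutes_conj (word_prod G f y)" if "y \<in> comm_words" for y
    using that by (intro commutes_conj_word base_rel) (auto simp: base_words_def)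
  then have "commutes_conj (word_prod G f y)" "commutes_conj (word_prod G f (rev y))"
    if "y \<in> comm_words" for y
    using that commutes_conj_inv[of "word_prod G f y"] by (simp_all add: inv_word_prod)
  note base = this[unfolded comm_words_def]
  \<comment> \<open>\<open>[c, a]^2\<close> is \<open>(ca)^4\<close>.\<close>
  have "word_prod G f (comm_word [GenA] @ comm_word [GenA]) = \<one>"
    using arg_cong[OF ac_rel, of "\<lambda>x. c \<otimes> (a \<otimes> (c \<otimes> x))"] ac_rel
    by (simp add: comm_word_def)
  then have "commutes_conj a"
    using commutes_conj_word[of "[GenA]"] by simp
  then show ?thesis
    using D_cases[OF assms]
      base[of "[GenA, GenB]"] base[of "[GenB, GenA, GenB]"]
      base[of "[GenA, GenB, GenA, GenB, GenA]"]
      base[of "[GenA, GenB, GenA, GenB, GenA, GenB]"]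
      base[of "[GenB, GenA, GenB, GenA, GenB, GenA, GenB]"]
    by (auto simp: m_assoc)
qed

lemma conj_commute:
  assumes "x \<in> carrier G" "y \<in> carrier G" "p \<in> carrier G" "q \<in> carrier G"
    and "x \<otimes> (p \<otimes> (inv q \<otimes> (y \<otimes> (q \<otimes> inv p)))) = p \<otimes> (inv q \<otimes> (y \<otimes> (q \<otimes> (inv p \<otimes> x))))"
  shows "(inv p \<otimes> (x \<otimes> p)) \<otimes> (inv q \<otimes> (y \<otimes> q)) = (inv q \<otimes> (y \<otimes> q)) \<otimes> (inv p \<otimes> (x \<otimes> p))"
  using arg_cong[OF assms(5), of "\<lambda>g. inv p \<otimes> (g \<otimes> p)"] assms(1-4)
  by (simp add: m_assoc)

text \<open>On generators, \<open>aba = \<phi>(c)\<close> and \<open>a \<phi>(c) a = b\<close>: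
  conjugation by \<open>a\<close> exchanges \<open>\<phi>(a)\<close> and \<open>\<phi>(c)\<close>,
  as \<delta> exchanges \<open>a\<close> and \<open>c\<close>.\<close>

lemma a_phi_D:
  assumes "d \<in> D"
  shows "a \<otimes> \<phi> d = \<phi> (\<delta> d) \<otimes> a"
  using assms
proof (induction rule: D.induct)
  case (D_a d)
  have "\<phi> (\<delta> (a \<otimes> d)) \<otimes> a = a \<otimes> (b \<otimes> (a \<otimes> (\<phi> (\<delta> d) \<otimes> a)))"
    using D_a.hyps delta_D by (simp add: m_assoc)
  also have "\<dots> = a \<otimes> (b \<otimes> \<phi> d)"
    using D_a.hyps by (simp flip: D_a.IH)
  finally show ?case using D_a.hyps by simp
next
  case (D_c d)
  then show ?case by (simp add: m_assoc)
qed simp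

text \<open>Both sides multiply conjugates of \<open>c\<close>, by \<open>\<phi>(d)\<close> and by
  \<open>\<phi>(e) a = a \<phi>(\<delta>(e))\<close>. The quotient of the conjugators is
  \<open>a \<phi>(\<delta>(e) d^-1)\<close>, which \<open>commutes_conj_D\<close> covers.\<close>

lemma phi_gens_commute:
  assumes "d \<in> D" "e \<in> D"
  shows "\<phi> (inv d \<otimes> (b \<otimes> d)) \<otimes> (a \<otimes> (\<phi> (inv e \<otimes> (b \<otimes> e)) \<otimes> a))
    = a \<otimes> (\<phi> (inv e \<otimes> (b \<otimes> e)) \<otimes> a) \<otimes> \<phi> (inv d \<otimes> (b \<otimes> d))"
proof -
  let ?p = "\<phi> d" and ?q = "a \<otimes> \<phi> (\<delta> e)"
  have e: "\<delta> e \<in> D" "inv (\<delta> e) \<in> D" "\<phi> e \<otimes> a = ?q"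
    using assms delta_D a_phi_D[of "\<delta> e"] D_inv by auto
  have e': "a \<otimes> inv (\<phi> e) = inv ?q"
    using arg_cong[OF e(3), of "m_inv G"] assms by (simp add: inv_mult_group)
  have "commutes_conj (?q \<otimes> inv ?p)"
    using commutes_conj_D[OF D_mult[OF e(1) D_inv[OF assms(1)]]] assms e
    by (simp add: m_assoc)
  then have "(inv ?p \<otimes> (c \<otimes> ?p)) \<otimes> (inv ?q \<otimes> (c \<otimes> ?q)) = (inv ?q \<otimes> (c \<otimes> ?q)) \<otimes> (inv ?p \<otimes> (c \<otimes> ?p))"
    using assms e by (intro conj_commute) (simp_all add: commutes_conj_def inv_mult_group m_assoc)
  moreover have "a \<otimes> (\<phi> (inv e \<otimes> (b \<otimes> e)) \<otimes> a) = inv ?q \<otimes> (c \<otimes> ?q)"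
    using assms by (simp add: m_assoc e(3) flip: e')
  ultimately show ?thesis
    using assms by simp
qed

lemma phi_B_commute:
  assumes "k \<in> B" "l \<in> B"
  shows "\<phi> k \<otimes> (a \<otimes> (\<phi> l \<otimes> a)) = a \<otimes> (\<phi> l \<otimes> a) \<otimes> \<phi> k"
proof -
  have mult: "x \<otimes> y \<otimes> z = z \<otimes> (x \<otimes> y)"
    if "x \<in> carrier G" "y \<in> carrier G" "z \<in> carrier G" "x \<otimes> z = z \<otimes> x" "y \<otimes> z = z \<otimes> y" for x y z
    using that by (metis m_assoc)
  have gen: "\<phi> (inv d \<otimes> (b \<otimes> d)) \<otimes> (a \<otimes> (\<phi> l \<otimes> a)) = a \<otimes> (\<phi> l \<otimes> a) \<otimes> \<phi> (inv d \<otimes> (b \<otimes> d))"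
    if d: "d \<in> D" for d
    using \<open>l \<in> B\<close>
  proof (induction rule: B.induct)
    case B_one
    then show ?case using d by simp
  next
    case (B_conj e l)
    let ?x = "a \<otimes> (\<phi> (inv e \<otimes> (b \<otimes> e)) \<otimes> a)" and ?y = "a \<otimes> (\<phi> l \<otimes> a)"
    have "a \<otimes> (\<phi> (inv e \<otimes> (b \<otimes> (e \<otimes> l))) \<otimes> a) = ?x \<otimes> ?y"
      using B_conj d by (simp add: m_assoc)
    then show ?case
      using mult[of ?x ?y "\<phi> (inv d \<otimes> (b \<otimes> d))"] phi_gens_commute[OF d] B_conj d by simp
  qed
  show ?thesis
    using \<open>k \<in> B\<close>
  proof (induction rule: B.induct)
    case B_one
    then show ?case using assms by simp
  next
    case (B_conj d k)
    have "\<phi> (inv d \<otimes> (b \<otimes> (d \<otimes> k))) = \<phi> (inv d \<otimes> (b \<otimes> d)) \<otimes> \<phi> k"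
      using B_conj by (simp add: m_assoc)
    then show ?case
      using mult[of "\<phi> (inv d \<otimes> (b \<otimes> d))" "\<phi> k"] gen B_conj assms by simp
  qed
qed

section \<open>Normal forms and their sections\<close>

text \<open>\<open>decomp x g\<^sub>0 g\<^sub>1\<close> says that \<open>x\<close> has a normal form with sections \<open>g\<^sub>0\<close>
  and \<open>g\<^sub>1\<close>: the factors \<open>\<phi>(d)\<close>, \<open>\<phi>(k)\<close> and \<open>a \<phi>(l) a\<close> have sections
  \<open>(d, \<delta>(d))\<close>, \<open>(k, 1)\<close> and \<open>(1, l)\<close>.\<close>

inductive decomp :: "'a \<Rightarrow> 'a \<Rightarrow> 'a \<Rightarrow> bool" where
  decompI: "d \<in> D \<Longrightarrow> k \<in> B \<Longrightarrow> l \<in> B \<Longrightarrow>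
    decomp (\<phi> d \<otimes> (\<phi> k \<otimes> (a \<otimes> (\<phi> l \<otimes> a)))) (d \<otimes> k) (\<delta> d \<otimes> l)"

lemma decomp_one: "decomp \<one> \<one> \<one>"
  using decompI[OF D_one B_one B_one] by simp

text \<open>Conjugation by \<open>a\<close> turns \<open>\<phi>(d)\<close> into
  \<open>\<phi>(\<delta>(d))\<close> and reverses the order of the other two types of factor;
  \<open>phi_B_commute\<close> restores it.\<close>

lemma decomp_a:
  assumes "decomp x g0 g1"
  shows "decomp (a \<otimes> (x \<otimes> a)) g1 g0"
  using assms
proof cases
  case (decompI d k l)
  have "\<phi> l \<otimes> (a \<otimes> (\<phi> k \<otimes> a)) = a \<otimes> (\<phi> k \<otimes> (a \<otimes> \<phi> l))"
    using phi_B_commute[of l k] decompI by (simp add: m_assoc)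
  moreover have "a \<otimes> (\<phi> d \<otimes> y) = \<phi> (\<delta> d) \<otimes> (a \<otimes> y)" if "y \<in> carrier G" for y
    using a_phi_D[OF \<open>d \<in> D\<close>] decompI that by (simp flip: m_assoc)
  ultimately have "a \<otimes> (x \<otimes> a) = \<phi> (\<delta> d) \<otimes> (\<phi> l \<otimes> (a \<otimes> (\<phi> k \<otimes> a)))"
    using decompI by (simp add: m_assoc)
  then show ?thesis
    using decomp.decompI[of "\<delta> d" l k] decompI delta_D[of d] by simp
qed

lemma decomp_b:
  assumes "decomp x g0 g1"
  shows "decomp (b \<otimes> x) (a \<otimes> g0) (c \<otimes> g1)"
  using assms
proof cases
  case (decompI d k l)
  then show ?thesis
    using decomp.decompI[of "a \<otimes> d" k l] D_a[of d] by (simp add: m_assoc)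
qed

text \<open>\<open>c = \<phi>(b)\<close> moves past \<open>\<phi>(d)\<close> as
  \<open>\<phi>(d^-1 b d)\<close> and is absorbed into \<open>k\<close>.\<close>

lemma decomp_c:
  assumes "decomp x g0 g1"
  shows "decomp (c \<otimes> x) (b \<otimes> g0) g1"
  using assms
proof cases
  case (decompI d k l)
  then show ?thesis
    using decomp.decompI[of d "inv d \<otimes> (b \<otimes> (d \<otimes> k))" l] B_conj[of d k]
    by (simp add: m_assoc)
qed

text \<open>As \<delta> kills \<open>B\<close>, applying it to \<open>d k = 1\<close> gives
  \<open>\<delta>(d) = 1\<close> and so \<open>l = 1\<close>; applying \<phi> gives
  \<open>\<phi>(d) \<phi>(k) = 1\<close>.\<close>

lemma decomp_one_one:
  assumes "decomp x \<one> \<one>"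
  shows "x = \<one>"
  using assms
proof cases
  case (decompI d k l)
  have x: "x = \<phi> d \<otimes> (\<phi> k \<otimes> (a \<otimes> (\<phi> l \<otimes> a)))"
    and dk: "d \<otimes> k = \<one>" and dl: "\<delta> d \<otimes> l = \<one>"
    using decompI(1-3) by simp_all
  note closed = \<open>d \<in> D\<close>[THEN D_closed] \<open>k \<in> B\<close>[THEN B_closed] \<open>l \<in> B\<close>[THEN B_closed]
  have "\<delta> d = \<one>"
    using arg_cong[OF dk, of \<delta>] delta_B[OF \<open>k \<in> B\<close>] closed by simp
  then have "l = \<one>"
    using dl closed by simp
  moreover have "\<phi> d \<otimes> \<phi> k = \<one>"
    using arg_cong[OF dk, of \<phi>] closed by simp
  ultimately show ?thesis
    using x closed by simp
qed

text \<open>A trailing \<open>a\<close> corrects the parity and leaves the sections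
  unchanged.\<close>

lemma decomp_word:
  "decomp (word_prod G f w \<otimes> (if even (count_list w GenA) then \<one> else a))
    (word_prod G f (sec False w)) (word_prod G f (sec True w))"
proof (induction w)
  case Nil
  then show ?case using decomp_one by simp
next
  case (Cons x w)
  then show ?case
    using decomp_a[OF Cons] decomp_b[OF Cons] decomp_c[OF Cons]
    by (cases x) (auto simp: m_assoc)
qed

section \<open>Words acting trivially: induction on the length\<close>

lemma word_prod_sections:
  assumes "even (count_list w GenA)"
    and "word_prod G f (sec False w) = \<one>" "word_prod G f (sec True w) = \<one>"
  shows "word_prod G f w = \<one>"
  using decomp_word[of w] decomp_one_one assms by simp

lemma word_prod_c:
  assumes "set w \<subseteq> {GenC}"
  shows "word_prod G f w = (if even (length w) then \<one> else c)"
  using assms by (induction w) auto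

lemma word_prod_of_act:
  assumes "act w = id"
  shows "word_prod G f w = \<one>"
  using assms
proof (induction "length w" arbitrary: w rule: less_induct)
  case less
  \<comment> \<open>Stated for every \<open>v\<close> no longer than \<open>w\<close>, because it is
    also applied to a section that may be as long as \<open>w\<close>.\<close>
  have with_a: "word_prod G f v = \<one>"
    if "length v \<le> length w" "GenA \<in> set v" "act v = id" for v
  proof -
    have "count_list v GenA > 0"
      using \<open>GenA \<in> set v\<close> by (metis count_list_0_iff not_gr_zero)
    then have "length (sec x v) < length w" for x
      using length_sec[of x v] \<open>length v \<le> length w\<close> by linarith
    then have "word_prod G f (sec x v) = \<one>" for x
      using less.hyps act_eq_idD[OF that(3)] by blast
    then show ?thesis
      using act_eq_idD[OF that(3)] by (blast intro: word_prod_sections)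
  qed
  show ?case
  proof (cases "GenA \<in> set w")
    case True
    then show ?thesis using with_a less.prems by blast
  next
    case False
    show ?thesis
    proof (cases "GenB \<in> set w")
      case True
      \<comment> \<open>The first section contains \<open>a\<close>, so \<open>with_a\<close>
        applies; the second is a power of \<open>c\<close>, even because it acts trivially.\<close>
      note act_sec = act_eq_idD[OF less.prems]
      have "length (sec False w) \<le> length w"
        using length_sec[of False w] by linarith
      then have "word_prod G f (sec False w) = \<one>"
        using with_a sec_without_a(2)[OF False True] act_sec by blast
      moreover have "word_prod G f (sec True w) = \<one>"
        using word_prod_c even_length_of_act_c sec_without_a(1)[OF False] act_sec by metis
      ultimately show ?thesis
        using act_sec by (blast intro: word_prod_sections)
    next
      case False
      then have "set w \<subseteq> {GenC}"
        using \<open>GenA \<notin> set w\<close> by (metis (full_types) gen.exhaust singletonI subsetI)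
      then show ?thesis
        using word_prod_c even_length_of_act_c less.prems by metis
    qed
  qed
qed

end


section \<open>The presentation\<close>

text \<open>\<open>b^2 = \<phi>(a^2)\<close> and \<open>c^2 = \<phi>(b^2)\<close>, so the
  presentation makes all generators involutions.\<close>

lemma square_relator: "[(x, True), (x, True)] \<in> img_relators"
proof -
  have 0: "[(GenA, True), (GenA, True)] \<in> base_relators"
    by (auto simp: base_relators_def Let_def free_gen_def numeral_eq_Suc reduce_def inv_letter_def)
  have 1: "phi [(GenA, True), (GenA, True)] = [(GenB, True), (GenB, True)]"
    "phi [(GenB, True), (GenB, True)] = [(GenC, True), (GenC, True)]"
    by (simp_all add: phi_def free_lift_def free_gen_def reduce_def inv_letter_def)
  have "(phi ^^ n) [(GenA, True), (GenA, True)] \<in> img_relators" for n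
    using 0 by (auto simp: img_relators_def)
  from this[of 0] this[of 1] this[of 2] show ?thesis
    using 1 by (cases x) (simp_all add: numeral_2_eq_2)
qed

interpretation pres: involutions "presented_group img_relators" "presented_gen img_relators"
proof -
  interpret group "presented_group img_relators"
    by (rule group_presented_group[OF img_relators_closed])
  show "involutions (presented_group img_relators) (presented_gen img_relators)"
  proof
    fix x :: gen
    show closed: "presented_gen img_relators x \<in> carrier (presented_group img_relators)"
      by (rule presented_gen_closed[OF img_relators_closed])
    show "presented_gen img_relators x \<otimes>\<^bsub>presented_group img_relators\<^esub> presented_gen img_relators x
      = \<one>\<^bsub>presented_group img_relators\<^esub>"
      using presented_group_relator[OF img_relators_closed square_relator[of x]] closed
      by (simp add: free_lift_def)
  qed
qed

text \<open>The word does not depend on \<open>f\<close>, so it can be evaluated at the generators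
  and at their images under \<phi> and \<delta>.\<close>

lemma img_relators_words:
  fixes H :: "('h, 'm) monoid_scheme"
  assumes "r \<in> img_relators"
  obtains n w where "w \<in> base_words"
    "\<And>f. involutions H f \<Longrightarrow> free_lift H f r = word_prod H f ((phi_word ^^ n) w)"
proof -
  obtain n r0 where r: "r = (phi ^^ n) r0" "r0 \<in> base_relators"
    using assms by (auto simp: img_relators_def)
  then have "r0 \<in> img_relators"
    unfolding img_relators_def by (metis (mono_tags, lifting) funpow_0 mem_Collect_eq)
  then have "reduced r0" using img_relators_closed by auto
  then show ?thesis
    using that[of "map fst r0" n] r base_relators_words by (auto simp: free_lift_phi_pow)
qed

lemma presented_relator_word:
  assumes "w \<in> base_words"
  shows "word_prod (presented_group img_relators) (presented_gen img_relators) ((phi_word ^^ n) w)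
    = \<one>\<^bsub>presented_group img_relators\<^esub>"
proof -
  obtain r where r: "r \<in> base_relators" "w = map fst r"
    using assms base_relators_words by auto
  then have rel: "(phi ^^ n) r \<in> img_relators" "(phi ^^ 0) r \<in> img_relators"
    unfolding img_relators_def by blast+
  then have "reduced r" using img_relators_closed by auto
  then show ?thesis
    using presented_group_relator[OF img_relators_closed rel(1)] r
    by (simp add: free_lift_phi_pow[OF pres.involutions_axioms])
qed

text \<open>\<phi> shifts \<open>n\<close> by one in the relators and \<delta> sends them to
  consequences of \<open>(ac)^4\<close> and the squares, so both factor through the
  presentation.\<close>

lemma presented_endos:
  obtains \<phi> \<delta>
  where "img_presentation (presented_group img_relators) (presented_gen img_relators) \<phi> \<delta>"
proof -
  let ?G = "presented_group img_relators" and ?g = "presented_gen img_relators"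
  let ?p = "\<lambda>x. word_prod ?G ?g (phi_letter x)" and ?d = "\<lambda>x. word_prod ?G ?g (delta_letter x)"
  have "free_lift ?G ?p r = \<one>\<^bsub>?G\<^esub>" "free_lift ?G ?d r = \<one>\<^bsub>?G\<^esub>" if "r \<in> img_relators" for r
  proof -
    obtain n w where w: "w \<in> base_words"
      "\<And>f. involutions ?G f \<Longrightarrow> free_lift ?G f r = word_prod ?G f ((phi_word ^^ n) w)"
      by (rule img_relators_words[where H = ?G, OF \<open>r \<in> img_relators\<close>], rule that)
    have "free_lift ?G ?p r = word_prod ?G ?g ((phi_word ^^ Suc n) w)"
      using w(2)[OF involutions_phi[OF pres.involutions_axioms]]
      by (simp add: pres.word_prod_concat[of phi_letter] phi_word_def[of "(phi_word ^^ n) w"])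
    then show "free_lift ?G ?p r = \<one>\<^bsub>?G\<^esub>"
      using presented_relator_word[OF w(1), of "Suc n"] by simp
    have "free_lift ?G ?d r = word_prod ?G ?g (delta_word ((phi_word ^^ n) w))"
      using w(2)[OF involutions_delta[OF pres.involutions_axioms]]
      by (simp add: pres.word_prod_concat[of delta_letter] delta_word_def)
    moreover have "word_prod ?G ?g [GenA, GenC, GenA, GenC, GenA, GenC, GenA, GenC] = \<one>\<^bsub>?G\<^esub>"
      using presented_relator_word[of "[GenA, GenC, GenA, GenC, GenA, GenC, GenA, GenC]" 0]
      by (simp add: base_words_def)
    ultimately show "free_lift ?G ?d r = \<one>\<^bsub>?G\<^esub>"
      using delta_relators[OF pres.involutions_axioms _ w(1)] by (simp del: word_prod_simps)
  qed
  note kill = this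
  obtain \<phi> where "\<phi> \<in> hom ?G ?G" "\<And>x. \<phi> (?g x) = ?p x"
    by (rule presented_group_universal
        [OF img_relators_closed pres.is_group pres.word_prod_closed kill(1)], assumption, rule that)
  moreover obtain \<delta> where "\<delta> \<in> hom ?G ?G" "\<And>x. \<delta> (?g x) = ?d x"
    by (rule presented_group_universal
        [OF img_relators_closed pres.is_group pres.word_prod_closed kill(2)], assumption, rule that)
  ultimately have "img_presentation ?G ?g \<phi> \<delta>"
    using presented_relator_word[where n = 0] by unfold_locales simp_all
  then show ?thesis using that by blast
qed

text \<open>Generators are their own inverses, so positive words exhaust the subgroup.\<close>

lemma carrier_img_group: "carrier img_group = range act"
proof -
  have "range gen_aut = {aut_a, aut_b, aut_c}"
    by (auto simp: image_iff) (metis gen_aut.simps gen.exhaust)+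
  then have "carrier tree_group \<inter> {aut_a, aut_b, aut_c} = range gen_aut"
    using auts_closed by (auto simp: tree_group_def)
  then have carrier: "carrier img_group = generate tree_group (range gen_aut)"
    by (simp add: img_group_def carrier_subgroup_generated)
  have "act w \<in> generate tree_group (range gen_aut)" for w
    by (induction w) (auto intro: generate.intros)
  moreover have "g \<in> range act" if "g \<in> generate tree_group (range gen_aut)" for g
    using that
  proof (induction rule: generate.induct)
    case one
    show ?case by (intro range_eqI[of _ _ "[]"]) simp
  next
    case (incl g)
    then obtain x where "g = gen_aut x" by auto
    then show ?case by (intro range_eqI[of _ _ "[x]"]) simp
  next
    case (inv g)
    then obtain x where "g = gen_aut x" by auto
    then show ?case by (intro range_eqI[of _ _ "[x]"]) simp
  next
    case (eng g h)
    then obtain u v where "g = act u" "h = act v" by auto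
    then show ?case by (intro range_eqI[of _ _ "u @ v"]) (simp only: tree.word_prod_append)
  qed
  ultimately show ?thesis using carrier by auto
qed

theorem theorem3p1:
  shows "\<exists>h \<in> iso (presented_group img_relators) img_group.
           h (presented_gen img_relators GenA) = aut_a
         \<and> h (presented_gen img_relators GenB) = aut_b
         \<and> h (presented_gen img_relators GenC) = aut_c"
proof -
  let ?G = "presented_group img_relators" and ?g = "presented_gen img_relators"
  have kill: "free_lift tree_group gen_aut r = \<one>\<^bsub>tree_group\<^esub>" if "r \<in> img_relators" for r
    using that
  proof (rule img_relators_words)
    fix n w
    assume "w \<in> base_words"
      "\<And>f. involutions tree_group f \<Longrightarrow>
        free_lift tree_group f r = word_prod tree_group f ((phi_word ^^ n) w)"
    then show ?thesis
      using act_phi_pow tree.involutions_axioms by (simp add: one_tree_group)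
  qed
  obtain h where h: "h \<in> hom ?G tree_group" and hg: "\<And>x. h (?g x) = gen_aut x"
    by (rule presented_group_universal
        [OF img_relators_closed tree.is_group tree.gen_closed kill], assumption, rule that)
  have act: "h (word_prod ?G ?g w) = act w" for w
    using hom_word_prod[OF pres.is_group tree.is_group h pres.gen_closed] by (simp add: hg)
  have words: "\<exists>w. X = word_prod ?G ?g w" if "X \<in> carrier ?G" for X
    using presented_group_cases[OF img_relators_closed that] pres.free_lift_eq_word_prod by metis
  then have carrier: "carrier ?G = range (word_prod ?G ?g)" by auto
  \<comment> \<open>These endomorphisms make the presented group an instance of the locale, where
    \<open>word_prod_of_act\<close> gives injectivity of \<open>h\<close>.\<close>
  obtain \<phi> \<delta> where "img_presentation ?G ?g \<phi> \<delta>"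
    by (rule presented_endos)
  then interpret img_presentation ?G ?g \<phi> \<delta> .
  have "group img_group"
    by (simp add: img_group_def tree.group_subgroup_generated)
  moreover have image: "h ` carrier ?G = carrier img_group"
    by (auto simp: carrier carrier_img_group act image_image)
  moreover have "h \<in> hom ?G img_group"
    using h image by (auto simp: hom_def img_group_def)
  moreover have "kernel ?G img_group h = {\<one>\<^bsub>?G\<^esub>}"
  proof -
    have "X = \<one>\<^bsub>?G\<^esub>" if "X \<in> carrier ?G" "h X = id" for X
      using that words[of X] word_prod_of_act act by auto
    moreover have "h \<one>\<^bsub>?G\<^esub> = id"
      using act[of "[]"] by (simp add: one_tree_group)
    ultimately show ?thesis
      by (auto simp: kernel_def img_group_def one_tree_group)
  qed
  ultimately have "h \<in> iso ?G img_group"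
    using iso_kernel_image[OF pres.is_group] by blast
  then show ?thesis using hg[of GenA] hg[of GenB] hg[of GenC] by auto
qed

end
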